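(* Let $d\geq 2$, let $\xi\in\mathbb{C}$ with $\xi^2=-1$, let $P(x,y)=\sum_{2\le i+j\le d}p_{i,j}x^iy^j$ with $p_{i,j}\in\mathbb{C}$, and let $X$ be the polynomial vector field of degree $d$ $$X=\xi(x\partial_x-y\partial_y)+P(x,y)\partial_x+\Big(\sum_{2\le i+j\le d}\overline{p_{j,i}}\,x^iy^j\Big)\partial_y .$$ Assume that $P$ satisfies the Cauchy-Riemann condition $\partial_yP=0$. Then the vector field $X$ is linearisable.
   Context: $X$ is the complex representation on $\mathbb{C}^2$ of a real planar polynomial vector field (with $y=\bar x$ on the real plane); in the condition $\partial_yP=0$, $x$ and $y$ are treated as independent variables. The linear part of $X$ at the origin is $X_{lin}=\xi(x\partial_x-y\partial_y)$. "Linearisable" means that, near the origin, $X$ is conjugate to $X_{lin}$ by an analytic change of coordinates. *)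

theory Defs
  imports "HOL-Complex_Analysis.Complex_Analysis"
begin

definition poly2 :: "nat \<Rightarrow> (nat \<Rightarrow> nat \<Rightarrow> complex) \<Rightarrow> complex \<Rightarrow> complex \<Rightarrow> complex" where
  "poly2 d p x y = (\<Sum>(i, j)\<in>{(i, j). 2 \<le> i + j \<and> i + j \<le> d}. p i j * x ^ i * y ^ j)"

text \<open>A vector field \<open>A \<partial>\<^sub>x + B \<partial>\<^sub>y\<close> on \<open>\<complex>\<^sup>2\<close> is represented by the map \<open>(x, y) \<mapsto> (A, B)\<close>.\<close>

definition lin_field :: "complex \<Rightarrow> complex \<times> complex \<Rightarrow> complex \<times> complex" where
  "lin_field \<xi> = (\<lambda>(x, y). (\<xi> * x, - \<xi> * y))"

definition vec_field ::
  "complex \<Rightarrow> nat \<Rightarrow> (nat \<Rightarrow> nat \<Rightarrow> complex) \<Rightarrow> complex \<times> complex \<Rightarrow> complex \<times> complex" where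
  "vec_field \<xi> d p = (\<lambda>(x, y). lin_field \<xi> (x, y) +
     (poly2 d p x y, poly2 d (\<lambda>i j. cnj (p j i)) x y))"

text \<open>Analyticity of functions of two independent complex variables: near every point, the
  function is the sum of a power series converging unconditionally on a polydisc.\<close>

definition analytic2_on :: "(complex \<times> complex \<Rightarrow> complex) \<Rightarrow> (complex \<times> complex) set \<Rightarrow> bool"
  (infixl "analytic2'_on" 50) where
  "f analytic2_on U \<longleftrightarrow> (\<forall>(x0, y0)\<in>U. \<exists>(a :: nat \<Rightarrow> nat \<Rightarrow> complex) r. r > 0 \<and>
     (\<forall>x\<in>ball x0 r. \<forall>y\<in>ball y0 r.
        ((\<lambda>(i, j). a i j * (x - x0) ^ i * (y - y0) ^ j) has_sum f (x, y)) UNIV))"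

definition analytic_map_on ::
  "(complex \<times> complex \<Rightarrow> complex \<times> complex) \<Rightarrow> (complex \<times> complex) set \<Rightarrow> bool" where
  "analytic_map_on \<phi> U \<longleftrightarrow> (fst \<circ> \<phi>) analytic2_on U \<and> (snd \<circ> \<phi>) analytic2_on U"

text \<open>The analytic change of coordinates \<open>\<phi>\<close> (with inverse \<open>\<psi>\<close>) fixes the origin and
  transports \<open>X\<close> to \<open>Y\<close>, i.e. \<open>D\<phi>(z) (X z) = Y (\<phi> z)\<close>.\<close>

definition analytically_conjugate ::
  "(complex \<times> complex \<Rightarrow> complex \<times> complex) \<Rightarrow> (complex \<times> complex \<Rightarrow> complex \<times> complex) \<Rightarrow> bool" where
  "analytically_conjugate X Y \<longleftrightarrow> (\<exists>U V \<phi> \<psi>.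
     open U \<and> open V \<and> 0 \<in> U \<and> 0 \<in> V \<and> \<phi> 0 = 0 \<and>
     \<phi> ` U = V \<and> (\<forall>z\<in>U. \<psi> (\<phi> z) = z) \<and>
     analytic_map_on \<phi> U \<and> analytic_map_on \<psi> V \<and>
     (\<forall>z\<in>U. \<exists>D. (\<phi> has_derivative D) (at z) \<and> D (X z) = Y (\<phi> z)))"

definition linearisable :: "complex \<Rightarrow> (complex \<times> complex \<Rightarrow> complex \<times> complex) \<Rightarrow> bool" where
  "linearisable \<xi> X \<longleftrightarrow> analytically_conjugate X (lin_field \<xi>)"

end

theory Submission
  imports Defs
begin

text \<open>
  If \<open>\<partial>\<^sub>yP = 0\<close>, then \<open>P\<close> is a function of \<open>x\<close> alone. The second
  nonlinearity is \<open>cnj (P (cnj y) (cnj x))\<close>, so it is a function of \<open>y\<close> alone, and the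
  planar field splits into two scalar fields of the form \<open>c z + z\<^sup>2 R z\<close> with \<open>c \<noteq> 0\<close> and
  \<open>R\<close> entire. There is no resonance to obstruct the linearisation of a scalar field: the equation
  \<open>f' z (c z + z\<^sup>2 R z) = c f z\<close> says that the logarithmic derivative of \<open>f\<close> is
  \<open>c / (c z + z\<^sup>2 R z) = 1 / z - R z / (c + z R z)\<close>, and the second term is holomorphic near \<open>0\<close>.
  If \<open>h\<close> is a primitive of \<open>- R z / (c + z R z)\<close>, then \<open>f z = z exp (h z)\<close> solves the equation, and
  \<open>f' 0 \<noteq> 0\<close> makes \<open>f\<close> invertible near \<open>0\<close> (\<open>scalar_linearisation\<close>).

  The change of coordinates of the plane is the product of the two scalar ones
  (\<open>analytically_conjugate_product\<close>). It is analytic in two variables because a holomorphic function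
  of one coordinate has a Taylor series that involves only powers of this coordinate.
\<close>

section \<open>Linearisation of a scalar holomorphic vector field\<close>

text \<open>The logarithmic derivative of the linearising map is \<open>1 / z - R z / (c + z R z)\<close>. Integrating
  only the regular part avoids the logarithm, which would be multivalued around \<open>0\<close>.\<close>

lemma scalar_linearisation:
  fixes c :: complex and R :: "complex \<Rightarrow> complex"
  assumes "c \<noteq> 0" and R: "R holomorphic_on UNIV"
  obtains S f g where "open S" "0 \<in> S" "f 0 = 0" "f holomorphic_on S" "open (f ` S)"
    "g holomorphic_on f ` S" "\<And>z. z \<in> S \<Longrightarrow> g (f z) = z"
    "\<And>z. z \<in> S \<Longrightarrow> deriv f z * (c * z + z\<^sup>2 * R z) = c * f z"
proof -
  define u where "u = (\<lambda>z. c + z * R z)"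
  have u_hol: "u holomorphic_on UNIV"
    unfolding u_def by (intro holomorphic_intros R)
  then have "isCont u 0"
    using continuous_on_eq_continuous_at[of UNIV u] holomorphic_on_imp_continuous_on by blast
  moreover have "u 0 \<noteq> 0"
    using assms(1) by (simp add: u_def)
  ultimately obtain r where "r > 0" and r: "\<And>z. z \<in> ball 0 r \<Longrightarrow> u z \<noteq> 0"
    using continuous_at_avoid[of 0 u 0] by (auto simp: dist_commute)
  have "(\<lambda>z. - R z / u z) holomorphic_on ball 0 r"
    using r by (intro holomorphic_intros holomorphic_on_subset[OF R] holomorphic_on_subset[OF u_hol]) auto
  then obtain h where h: "\<And>z. z \<in> ball 0 r \<Longrightarrow>
      (h has_field_derivative - R z / u z) (at z within ball 0 r)"
    by (rule holomorphic_convex_primitive'[OF convex_ball open_ball]) (rule that)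
  define f where "f = (\<lambda>z. z * exp (h z))"
  have f': "(f has_field_derivative exp (h z) * (c / u z)) (at z)" if "z \<in> ball 0 r" for z
  proof -
    have "(h has_field_derivative - R z / u z) (at z)"
      using h[OF that] that by (simp add: at_within_open[of _ "ball 0 r"])
    then have "(f has_field_derivative
        exp (h z) + z * (exp (h z) * (- R z / u z))) (at z)"
      unfolding f_def by (auto intro!: derivative_eq_intros)
    moreover have "exp (h z) + z * (exp (h z) * (- R z / u z)) = exp (h z) * (c / u z)"
      using r[OF that] by (simp add: field_simps) (simp add: u_def field_simps)
    ultimately show ?thesis by simp
  qed
  have f_hol: "f holomorphic_on ball 0 r"
    using f' by (meson field_differentiable_at_within field_differentiable_def holomorphic_on_def)
  have f'0: "deriv f 0 \<noteq> 0"
    using DERIV_imp_deriv[OF f'[of 0]] \<open>r > 0\<close> assms(1) \<open>u 0 \<noteq> 0\<close> by simp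
  have "(0::complex) \<in> ball 0 r"
    using \<open>r > 0\<close> by simp
  then obtain s where "s > 0" and s: "ball (0::complex) s \<subseteq> ball 0 r" "inj_on f (ball 0 s)"
    by (rule has_complex_derivative_locally_injective[OF f_hol _ open_ball f'0]) (rule that)
  have fs: "f holomorphic_on ball 0 s"
    using f_hol s(1) by (rule holomorphic_on_subset)
  obtain g where g: "g holomorphic_on f ` ball 0 s" "\<And>z. z \<in> ball 0 s \<Longrightarrow> g (f z) = z"
    by (rule holomorphic_has_inverse[OF fs open_ball s(2)]) (rule that)
  show thesis
  proof (rule that[of "ball 0 s" f g])
    show "open (f ` ball 0 s)"
      using fs s(2) by (intro open_mapping_thm3) auto
    fix z :: complex assume "z \<in> ball 0 s"
    then have z: "z \<in> ball 0 r" using s(1) by auto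
    have "deriv f z * (z * u z) = c * f z"
      using DERIV_imp_deriv[OF f'[OF z]] r[OF z] by (simp add: f_def)
    then show "deriv f z * (c * z + z\<^sup>2 * R z) = c * f z"
      by (simp add: u_def power2_eq_square algebra_simps)
  qed (use \<open>s > 0\<close> fs g in \<open>auto simp: f_def\<close>)
qed

section \<open>Holomorphic functions of one coordinate\<close>

lemma holomorphic_has_sum_Taylor:
  assumes "f holomorphic_on ball z0 r" "z \<in> ball z0 r"
  shows "((\<lambda>n. (deriv ^^ n) f z0 / fact n * (z - z0) ^ n) has_sum f z) UNIV"
proof (rule norm_summable_imp_has_sum)
  let ?a = "\<lambda>n. (deriv ^^ n) f z0 / fact n"
  show "(\<lambda>n. ?a n * (z - z0) ^ n) sums f z"
    using holomorphic_power_series[OF assms] .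
  \<comment> \<open>Absolute convergence at \<open>z\<close> follows from convergence at a point farther from the centre.\<close>
  obtain t where t: "dist z0 z < t" "t < r"
    using assms(2) dense by auto
  then have "0 < t"
    using zero_le_dist[of z0 z] by linarith
  then have "z0 + of_real t \<in> ball z0 r"
    using t by (simp add: dist_norm)
  then have "summable (\<lambda>n. ?a n * (of_real t) ^ n)"
    using holomorphic_power_series[OF assms(1), of "z0 + of_real t"] by (simp add: sums_iff)
  then show "summable (\<lambda>n. norm (?a n * (z - z0) ^ n))"
    by (rule powser_insidea) (use t in \<open>simp add: dist_norm norm_minus_commute\<close>)
qed

lemma analytic2_on_comp_fst:
  assumes "open S" "f holomorphic_on S"
  shows "(\<lambda>z. f (fst z)) analytic2_on S \<times> T"
  unfolding analytic2_on_def
proof safe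
  fix x0 y0 assume "x0 \<in> S"
  then obtain r where "r > 0" and r: "ball x0 r \<subseteq> S"
    using assms(1) open_contains_ball by blast
  define a where "a = (\<lambda>i j. if j = (0::nat) then (deriv ^^ i) f x0 / fact i else (0::complex))"
  have "((\<lambda>(i, j). a i j * (x - x0) ^ i * (y - y0) ^ j) has_sum f x) UNIV"
    if "x \<in> ball x0 r" for x y
  proof -
    have "((\<lambda>i. (deriv ^^ i) f x0 / fact i * (x - x0) ^ i) has_sum f x) UNIV"
      using holomorphic_on_subset[OF assms(2) r] that by (rule holomorphic_has_sum_Taylor)
    then have "((\<lambda>(i, j). a i j * (x - x0) ^ i * (y - y0) ^ j) has_sum f x) (range (\<lambda>i. (i, 0)))"
      by (subst has_sum_reindex) (auto simp: a_def inj_on_def o_def)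
    then show ?thesis
      by (rule has_sum_cong_neutral[THEN iffD1, rotated -1]) (auto simp: a_def)
  qed
  with \<open>r > 0\<close> show "\<exists>a r. r > 0 \<and> (\<forall>x\<in>ball x0 r. \<forall>y\<in>ball y0 r.
      ((\<lambda>(i, j). a i j * (x - x0) ^ i * (y - y0) ^ j) has_sum f (fst (x, y))) UNIV)"
    by (intro exI[of _ a] exI[of _ r]) simp
qed

lemma analytic2_on_swap:
  assumes "f analytic2_on T \<times> S"
  shows "(\<lambda>z. f (snd z, fst z)) analytic2_on S \<times> T"
  unfolding analytic2_on_def
proof safe
  fix x0 y0 assume "x0 \<in> S" "y0 \<in> T"
  then obtain a r where "r > 0" and a: "\<And>x y. x \<in> ball y0 r \<Longrightarrow> y \<in> ball x0 r \<Longrightarrow>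
      ((\<lambda>(i, j). a i j * (x - y0) ^ i * (y - x0) ^ j) has_sum f (x, y)) UNIV"
    using assms unfolding analytic2_on_def by blast
  have "((\<lambda>(i, j). a j i * (x - x0) ^ i * (y - y0) ^ j) has_sum f (y, x)) UNIV"
    if "x \<in> ball x0 r" "y \<in> ball y0 r" for x y
  proof -
    have "((\<lambda>(i, j). a j i * (x - x0) ^ i * (y - y0) ^ j) \<circ> prod.swap has_sum f (y, x)) UNIV"
      using a[OF that(2,1)] by (simp add: o_def case_prod_unfold mult_ac)
    then show ?thesis
      by (subst (asm) has_sum_reindex[symmetric]) auto
  qed
  with \<open>r > 0\<close> show "\<exists>a r. r > 0 \<and> (\<forall>x\<in>ball x0 r. \<forall>y\<in>ball y0 r.
      ((\<lambda>(i, j). a i j * (x - x0) ^ i * (y - y0) ^ j) has_sum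
        f (snd (x, y), fst (x, y))) UNIV)"
    by (intro exI[of _ "\<lambda>i j. a j i"] exI[of _ r]) simp
qed

lemma analytic_map_on_map_prod:
  assumes "open S" "f holomorphic_on S" "open T" "g holomorphic_on T"
  shows "analytic_map_on (map_prod f g) (S \<times> T)"
  using analytic2_on_comp_fst[OF assms(1,2), of T]
    analytic2_on_swap[OF analytic2_on_comp_fst[OF assms(3,4), of S]]
  by (simp add: analytic_map_on_def o_def)

section \<open>Decoupled planar fields\<close>

lemma analytically_conjugate_product:
  fixes a b :: complex
  assumes "a \<noteq> 0" "b \<noteq> 0" and R: "R holomorphic_on UNIV" and Q: "Q holomorphic_on UNIV"
  shows "analytically_conjugate
    (map_prod (\<lambda>x. a * x + x\<^sup>2 * R x) (\<lambda>y. b * y + y\<^sup>2 * Q y))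
    (map_prod ((*) a) ((*) b))"
proof -
  obtain S f f' where f: "open S" "0 \<in> S" "f 0 = 0" "f holomorphic_on S" "open (f ` S)"
      "f' holomorphic_on f ` S" "\<And>x. x \<in> S \<Longrightarrow> f' (f x) = x"
      "\<And>x. x \<in> S \<Longrightarrow> deriv f x * (a * x + x\<^sup>2 * R x) = a * f x"
    using scalar_linearisation[OF assms(1) R] by blast
  obtain T g g' where g: "open T" "0 \<in> T" "g 0 = 0" "g holomorphic_on T" "open (g ` T)"
      "g' holomorphic_on g ` T" "\<And>y. y \<in> T \<Longrightarrow> g' (g y) = y"
      "\<And>y. y \<in> T \<Longrightarrow> deriv g y * (b * y + y\<^sup>2 * Q y) = b * g y"
    using scalar_linearisation[OF assms(2) Q] by blast
  let ?\<phi> = "map_prod f g"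
  have deriv: "(?\<phi> has_derivative (\<lambda>v. (deriv f x * fst v, deriv g y * snd v))) (at (x, y))"
    if "x \<in> S" "y \<in> T" for x y
  proof -
    have "(f has_derivative (*) (deriv f x)) (at (fst (x, y)))"
      using holomorphic_derivI[OF f(4,1) that(1)] by (simp add: has_field_derivative_def)
    note f_fst = has_derivative_compose[OF has_derivative_fst[OF has_derivative_ident] this]
    have "(g has_derivative (*) (deriv g y)) (at (snd (x, y)))"
      using holomorphic_derivI[OF g(4,1) that(2)] by (simp add: has_field_derivative_def)
    note g_snd = has_derivative_compose[OF has_derivative_snd[OF has_derivative_ident] this]
    show ?thesis
      using has_derivative_Pair[OF f_fst g_snd] by (simp add: map_prod_def case_prod_unfold)
  qed
  show ?thesis
    unfolding analytically_conjugate_def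
  proof (intro exI conjI ballI)
    show "?\<phi> ` (S \<times> T) = f ` S \<times> g ` T"
      by (rule map_prod_surj_on) simp_all
    show "analytic_map_on ?\<phi> (S \<times> T)" "analytic_map_on (map_prod f' g') (f ` S \<times> g ` T)"
      using f g by (intro analytic_map_on_map_prod; simp)+
    show "open (S \<times> T)" "open (f ` S \<times> g ` T)"
      using f g by (intro open_Times; simp)+
    show "0 \<in> S \<times> T" "0 \<in> f ` S \<times> g ` T" "?\<phi> 0 = 0"
      using f(2,3) g(2,3) by (force simp: zero_prod_def)+
    fix z assume "z \<in> S \<times> T"
    then obtain x y where z: "z = (x, y)" "x \<in> S" "y \<in> T" by auto
    show "map_prod f' g' (?\<phi> z) = z"
      using z f(7) g(7) by simp
    show "(?\<phi> has_derivative (\<lambda>v. (deriv f (fst z) * fst v, deriv g (snd z) * snd v))) (at z)"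
      using deriv z by simp
    show "(deriv f (fst z) * fst (map_prod (\<lambda>x. a * x + x\<^sup>2 * R x) (\<lambda>y. b * y + y\<^sup>2 * Q y) z),
        deriv g (snd z) * snd (map_prod (\<lambda>x. a * x + x\<^sup>2 * R x) (\<lambda>y. b * y + y\<^sup>2 * Q y) z))
      = map_prod ((*) a) ((*) b) (?\<phi> z)"
      using z f(8) g(8) by simp
  qed
qed

section \<open>The Cauchy--Riemann condition decouples the field\<close>

lemma poly2_transpose: "poly2 d (\<lambda>i j. p j i) x y = poly2 d p y x"
  unfolding poly2_def
  by (rule sum.reindex_bij_witness[of _ prod.swap prod.swap]) (auto simp: add.commute mult_ac)

lemma cnj_poly2: "cnj (poly2 d p x y) = poly2 d (\<lambda>i j. cnj (p i j)) (cnj x) (cnj y)"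
  by (simp add: poly2_def case_prod_unfold)

lemma poly2_at_0_factor:
  obtains R where "R holomorphic_on UNIV" "\<And>x. poly2 d p x 0 = x\<^sup>2 * R x"
proof
  let ?I = "{(i, j). 2 \<le> i + j \<and> i + j \<le> d}"
  let ?R = "\<lambda>x::complex. \<Sum>(i, j)\<in>?I. p i j * x ^ (i - 2) * 0 ^ j"
  show "?R holomorphic_on UNIV"
    unfolding case_prod_unfold by (intro holomorphic_intros)
  show "poly2 d p x 0 = x\<^sup>2 * ?R x" for x
    unfolding poly2_def sum_distrib_left
  proof (rule sum.cong)
    fix k assume "k \<in> ?I"
    then obtain i j where k: "k = (i, j)" "2 \<le> i + j" by auto
    show "(case k of (i, j) \<Rightarrow> p i j * x ^ i * 0 ^ j)
        = x\<^sup>2 * (case k of (i, j) \<Rightarrow> p i j * x ^ (i - 2) * 0 ^ j)"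
    proof (cases "j = 0")
      case True
      then have "x ^ (2 + (i - 2)) = x ^ i"
        using k(2) by (intro arg_cong[of _ _ "\<lambda>n. x ^ n"]) simp
      then have "x ^ i = x\<^sup>2 * x ^ (i - 2)"
        by (simp only: power_add)
      with k True show ?thesis
        by (simp only: prod.case power_0 mult_1_right mult.left_commute)
    qed (simp add: k)
  qed simp
qed

lemma poly2_indep_snd:
  assumes "\<forall>x y. deriv (\<lambda>t. poly2 d p x t) y = 0"
  shows "poly2 d p x y = poly2 d p x 0"
proof -
  have "(\<lambda>t. poly2 d p x t) holomorphic_on UNIV"
    unfolding poly2_def case_prod_unfold by (intro holomorphic_intros)
  then have "((\<lambda>t. poly2 d p x t) has_field_derivative 0) (at t)" for t
    using holomorphic_derivI[OF _ open_UNIV UNIV_I, of "\<lambda>t. poly2 d p x t" t] assms by simp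
  then have "\<exists>c. \<forall>t\<in>UNIV. poly2 d p x t = c"
    by (intro has_field_derivative_zero_constant) simp_all
  then show ?thesis
    by auto
qed

theorem lemma9:
  fixes d :: nat and \<xi> :: complex and p :: "nat \<Rightarrow> nat \<Rightarrow> complex"
  assumes "d \<ge> 2"
    and "\<xi>\<^sup>2 = -1"
    and "\<forall>x y. deriv (\<lambda>t. poly2 d p x t) y = 0"
  shows "linearisable \<xi> (vec_field \<xi> d p)"
proof -
  have "\<xi> \<noteq> 0"
    using assms(2) by auto
  obtain R where R: "R holomorphic_on UNIV" "\<And>x. poly2 d p x 0 = x\<^sup>2 * R x"
    using poly2_at_0_factor[of d p] by blast
  obtain Q where Q: "Q holomorphic_on UNIV"
      "\<And>y. poly2 d (\<lambda>i j. cnj (p i j)) y 0 = y\<^sup>2 * Q y"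
    using poly2_at_0_factor[of d "\<lambda>i j. cnj (p i j)"] by blast
  have fst_eq: "poly2 d p x y = x\<^sup>2 * R x" for x y
    using poly2_indep_snd[OF assms(3)] R(2) by simp
  have snd_eq: "poly2 d (\<lambda>i j. cnj (p j i)) x y = y\<^sup>2 * Q y" for x y
  proof -
    have "poly2 d (\<lambda>i j. cnj (p j i)) x y = cnj (poly2 d p (cnj y) (cnj x))"
      using poly2_transpose[of d "\<lambda>i j. cnj (p i j)" x y] by (simp add: cnj_poly2)
    also have "\<dots> = cnj (poly2 d p (cnj y) 0)"
      using poly2_indep_snd[OF assms(3)] by simp
    also have "\<dots> = y\<^sup>2 * Q y"
      by (simp add: cnj_poly2 Q(2))
    finally show ?thesis .
  qed
  have "vec_field \<xi> d p = map_prod (\<lambda>x. \<xi> * x + x\<^sup>2 * R x) (\<lambda>y. - \<xi> * y + y\<^sup>2 * Q y)"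
    by (auto simp: fun_eq_iff vec_field_def lin_field_def fst_eq snd_eq)
  moreover have "lin_field \<xi> = map_prod ((*) \<xi>) ((*) (- \<xi>))"
    by (auto simp: fun_eq_iff lin_field_def)
  ultimately show ?thesis
    using analytically_conjugate_product[of \<xi> "- \<xi>" R Q] \<open>\<xi> \<noteq> 0\<close> R(1) Q(1)
    by (simp add: linearisable_def)
qed

end
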